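(* Let $G$ be a connected finite loopless multigraph and let $q\in V(G)$. There is a bijection between the set of maximal superstable configurations on $G$ with respect to $q$ and the set of acyclic orientations of $G$ with unique source $q$.
   Context: A finite loopless multigraph $G$ has a finite nonempty vertex set $V=V(G)$ and a finite multiset $E(G)$ of unordered pairs $\{v,w\}$ of vertices with $v\neq w$. $G$ is connected if for every nonempty proper subset $S\subsetneq V$ there is at least one edge between $S$ and $V\setminus S$. An orientation $\mathcal{O}$ of $G$ assigns a direction to each edge. It is formalized as a multiset of ordered pairs of vertices that is count-preserving (for all $v,w$, the number of pairs $(v,w)$ plus the number of pairs $(w,v)$ equals the number of edges between $v$ and $w$) and has no bidirectional edges ($(v,w)$ and $(w,v)$ do not both occur, so all parallel edges between two vertices point the same way). A source of $\mathcal{O}$ is a vertex with no edges directed into it; $\mathcal{O}$ has unique source $q$ if $q$ is its only source. $\mathcal{O}$ is acyclic if no directed path repeats a vertex. A configuration with respect to $q$ is a function $c:V\setminus\{q\}\to\mathbb{Z}_{\ge 0}$. It is superstable if for every nonempty $S\subseteq V\setminus\{q\}$ there is $v\in S$ such that $c(v)$ is less than the number of edges (with multiplicity) from $v$ to $V\setminus S$ (i.e. sending one chip along each edge from $S$ to $V\setminus S$ puts some vertex of $S$ into debt). A superstable configuration $c$ is maximal if there is no superstable configuration $c'\neq c$ with $c'(v)\ge c(v)$ for all $v\ne q$. *)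

theory Defs
  imports "HOL-Library.Multiset" "HOL-Library.FuncSet"
begin

text \<open>An undirected edge joining \<open>v\<close> and \<open>w\<close> is the two-element set \<open>{v, w}\<close>, so the number of
  edges between \<open>v\<close> and \<open>w\<close> is \<open>count E {v, w}\<close>.\<close>

definition multigraph :: "'a set \<Rightarrow> 'a set multiset \<Rightarrow> bool" where
  "multigraph V E \<longleftrightarrow>
     finite V \<and> V \<noteq> {} \<and> (\<forall>e \<in># E. \<exists>v\<in>V. \<exists>w\<in>V. v \<noteq> w \<and> e = {v, w})"

definition connected_graph :: "'a set \<Rightarrow> 'a set multiset \<Rightarrow> bool" where
  "connected_graph V E \<longleftrightarrow>
     (\<forall>S. S \<noteq> {} \<and> S \<subset> V \<longrightarrow> (\<exists>v\<in>S. \<exists>w\<in>V - S. {v, w} \<in># E))"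

text \<open>In the next definition \<open>v\<close> and \<open>w\<close> need not be restricted to the vertex set: for a
  multigraph, count preservation forces every directed edge to join two distinct vertices of it.\<close>

definition orientation :: "'a set multiset \<Rightarrow> ('a \<times> 'a) multiset \<Rightarrow> bool" where
  "orientation E D \<longleftrightarrow>
     (\<forall>v w. count D (v, w) + count D (w, v) = count E {v, w}) \<and>
     (\<forall>v w. \<not> ((v, w) \<in># D \<and> (w, v) \<in># D))"

definition source :: "'a set \<Rightarrow> ('a \<times> 'a) multiset \<Rightarrow> 'a \<Rightarrow> bool" where
  "source V D v \<longleftrightarrow> v \<in> V \<and> (\<forall>u. (u, v) \<notin># D)"

definition unique_source :: "'a set \<Rightarrow> ('a \<times> 'a) multiset \<Rightarrow> 'a \<Rightarrow> bool" where
  "unique_source V D q \<longleftrightarrow> source V D q \<and> (\<forall>v. source V D v \<longrightarrow> v = q)"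

text \<open>A directed path is given by the list of the vertices it visits.\<close>

definition directed_path :: "('a \<times> 'a) multiset \<Rightarrow> 'a list \<Rightarrow> bool" where
  "directed_path D p \<longleftrightarrow> successively (\<lambda>v w. (v, w) \<in># D) p"

definition acyclic_orientation :: "'a set multiset \<Rightarrow> ('a \<times> 'a) multiset \<Rightarrow> bool" where
  "acyclic_orientation E D \<longleftrightarrow> orientation E D \<and> (\<forall>p. directed_path D p \<longrightarrow> distinct p)"

text \<open>Configurations are extensional functions (with the value \<open>undefined\<close> outside \<open>V - {q}\<close>), so
  that each function on \<open>V - {q}\<close> is represented exactly once.\<close>

definition configurations :: "'a set \<Rightarrow> 'a \<Rightarrow> ('a \<Rightarrow> nat) set" where
  "configurations V q = (V - {q}) \<rightarrow>\<^sub>E UNIV"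

definition outdeg :: "'a set \<Rightarrow> 'a set multiset \<Rightarrow> 'a set \<Rightarrow> 'a \<Rightarrow> nat" where
  "outdeg V E S v = (\<Sum>w\<in>V - S. count E {v, w})"

definition superstable :: "'a set \<Rightarrow> 'a set multiset \<Rightarrow> 'a \<Rightarrow> ('a \<Rightarrow> nat) \<Rightarrow> bool" where
  "superstable V E q c \<longleftrightarrow>
     c \<in> configurations V q \<and>
     (\<forall>S. S \<noteq> {} \<and> S \<subseteq> V - {q} \<longrightarrow> (\<exists>v\<in>S. c v < outdeg V E S v))"

definition maximal_superstable :: "'a set \<Rightarrow> 'a set multiset \<Rightarrow> 'a \<Rightarrow> ('a \<Rightarrow> nat) \<Rightarrow> bool" where
  "maximal_superstable V E q c \<longleftrightarrow>
     superstable V E q c \<and>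
     \<not> (\<exists>c'. superstable V E q c' \<and> c' \<noteq> c \<and> (\<forall>v\<in>V - {q}. c v \<le> c' v))"

end

theory Submission
  imports Defs
begin

text \<open>
  The bijection is the inverse of \<open>D \<mapsto> c\<^sub>D\<close>, where \<open>c\<^sub>D(v)\<close> is the indegree of \<open>v\<close> in \<open>D\<close> minus one.

  An acyclic orientation, restricted to a nonempty set \<open>S\<close> of vertices, still has a source \<open>v\<close>.
  All edges into \<open>v\<close> then come from outside \<open>S\<close>, so \<open>v\<close> goes into debt when \<open>S\<close> fires: \<open>c\<^sub>D\<close> is
  superstable (\<open>superstable_indegree_config\<close>). Conversely, Dhar's burning process started at \<open>q\<close>
  enumerates the vertices so that each \<open>v \<noteq> q\<close> has more than \<open>c(v)\<close> edges to earlier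
  vertices (\<open>superstable_burning_order\<close>); orienting every edge from earlier to later produces an
  orientation \<open>D\<close> with \<open>c \<le> c\<^sub>D\<close> (\<open>superstable_below_orientation\<close>).

  The indegrees of any orientation add up to the number of edges, so two configurations of the form
  \<open>c\<^sub>D\<close> are equal as soon as they are comparable. Together with the previous paragraph this says that
  the maximal superstable configurations are exactly the \<open>c\<^sub>D\<close>.

  Finally, an acyclic orientation is determined by its indegrees (\<open>orientation_eq_if_indegree_eq\<close>):
  if \<open>D\<close> and \<open>D'\<close> have equal indegrees, the edges on which they differ form, in \<open>D\<close>, a subgraph
  in which each vertex with an outgoing edge also has an incoming one, and a nonempty
  subgraph of this kind contains a cycle.
\<close>

section \<open>Orientations and indegrees\<close>

definition indegree :: "'a set \<Rightarrow> ('a \<times> 'a) multiset \<Rightarrow> 'a \<Rightarrow> nat" where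
  "indegree V D v = (\<Sum>u\<in>V. count D (u, v))"

lemma multigraph_edge_in_vertices:
  assumes "multigraph V E" "{u, v} \<in># E"
  shows "u \<in> V" "v \<in> V" "u \<noteq> v"
proof -
  obtain a b where "a \<in> V" "b \<in> V" "a \<noteq> b" "{u, v} = {a, b}"
    using assms unfolding multigraph_def by blast
  then show "u \<in> V" "v \<in> V" "u \<noteq> v" by (auto simp: doubleton_eq_iff)
qed

lemma orientation_count:
  "orientation E D \<Longrightarrow> count D (v, w) + count D (w, v) = count E {v, w}"
  by (simp add: orientation_def)

lemma orientation_edge:
  assumes "orientation E D" "(u, v) \<in># D"
  shows "{u, v} \<in># E"
  using assms(2) orientation_count[OF assms(1), of u v]
  by (metis add_is_0 count_eq_zero_iff)

lemma indegree_pos_iff: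
  assumes "multigraph V E" "orientation E D"
  shows "0 < indegree V D v \<longleftrightarrow> (\<exists>u. (u, v) \<in># D)"
proof -
  have "finite V" using assms(1) by (simp add: multigraph_def)
  then have "indegree V D v = 0 \<longleftrightarrow> (\<forall>u\<in>V. (u, v) \<notin># D)"
    by (simp add: indegree_def count_eq_zero_iff)
  then have "0 < indegree V D v \<longleftrightarrow> (\<exists>u\<in>V. (u, v) \<in># D)" by auto
  then show ?thesis
    using multigraph_edge_in_vertices(1)[OF assms(1) orientation_edge[OF assms(2)]] by blast
qed

lemma unique_source_iff_indegree:
  assumes "multigraph V E" "orientation E D" "q \<in> V"
  shows "unique_source V D q \<longleftrightarrow> indegree V D q = 0 \<and> (\<forall>v\<in>V - {q}. 0 < indegree V D v)"
proof -
  have "source V D v \<longleftrightarrow> v \<in> V \<and> indegree V D v = 0" for v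
    using indegree_pos_iff[OF assms(1,2), of v] unfolding source_def by auto
  then have "unique_source V D q \<longleftrightarrow>
      indegree V D q = 0 \<and> (\<forall>v. v \<in> V \<and> indegree V D v = 0 \<longrightarrow> v = q)"
    using assms(3) unfolding unique_source_def by simp
  also have "(\<forall>v. v \<in> V \<and> indegree V D v = 0 \<longrightarrow> v = q)
      \<longleftrightarrow> (\<forall>v\<in>V - {q}. 0 < indegree V D v)"
    by (metis Diff_iff gr0I less_irrefl singleton_iff)
  finally show ?thesis .
qed

lemma sum_indegree:
  assumes "orientation E D"
  shows "2 * (\<Sum>v\<in>V. indegree V D v) = (\<Sum>v\<in>V. \<Sum>u\<in>V. count E {u, v})"
proof -
  have "(\<Sum>v\<in>V. indegree V D v) = (\<Sum>v\<in>V. \<Sum>u\<in>V. count D (v, u))"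
    unfolding indegree_def by (rule sum.swap)
  then have "2 * (\<Sum>v\<in>V. indegree V D v)
      = (\<Sum>v\<in>V. \<Sum>u\<in>V. count D (u, v) + count D (v, u))"
    by (simp add: indegree_def sum.distrib)
  then show ?thesis by (simp add: orientation_count[OF assms])
qed

lemma indegree_eq_if_le:
  assumes "finite V" "orientation E D" "orientation E D'"
    and le: "\<And>v. v \<in> V \<Longrightarrow> indegree V D v \<le> indegree V D' v" and "v \<in> V"
  shows "indegree V D v = indegree V D' v"
proof (rule ccontr)
  assume "indegree V D v \<noteq> indegree V D' v"
  with le[OF \<open>v \<in> V\<close>] have "indegree V D v < indegree V D' v" by simp
  with le \<open>v \<in> V\<close> have "(\<Sum>v\<in>V. indegree V D v) < (\<Sum>v\<in>V. indegree V D' v)"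
    by (intro sum_strict_mono_ex1[OF \<open>finite V\<close>]) auto
  with sum_indegree[OF assms(2), of V] sum_indegree[OF assms(3), of V] show False by simp
qed

section \<open>Acyclicity\<close>

text \<open>If every vertex of \<open>S\<close> had a predecessor in \<open>S\<close>, going backwards would produce directed paths in
  \<open>S\<close> of any length, and one with more than \<open>card S\<close> vertices repeats a vertex.\<close>

lemma acyclic_orientation_source_in_subset:
  assumes ac: "acyclic_orientation E D" and fin: "finite S" and ne: "S \<noteq> {}"
  shows "\<exists>v\<in>S. \<forall>u\<in>S. (u, v) \<notin># D"
proof (rule ccontr)
  assume "\<not> ?thesis"
  then have pred: "\<exists>u\<in>S. (u, v) \<in># D" if "v \<in> S" for v using that by blast
  have "\<exists>p. directed_path D p \<and> length p = Suc n \<and> set p \<subseteq> S" for n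
  proof (induction n)
    case 0
    obtain v where "v \<in> S" using ne by blast
    then show ?case by (intro exI[of _ "[v]"]) (simp add: directed_path_def)
  next
    case (Suc n)
    then obtain p where p: "directed_path D p" "length p = Suc n" "set p \<subseteq> S" by blast
    then obtain v r where vr: "p = v # r" by (cases p) auto
    obtain u where "u \<in> S" "(u, v) \<in># D" using pred[of v] p vr by auto
    with p vr show ?case
      by (intro exI[of _ "u # p"]) (auto simp: directed_path_def)
  qed
  then obtain p where p: "directed_path D p" "length p = Suc (card S)" "set p \<subseteq> S" by blast
  then have "distinct p" using ac by (simp add: acyclic_orientation_def)
  then have "length p \<le> card S" using p(3) fin by (metis card_mono distinct_card)
  with p(2) show False by simp
qed

text \<open>The tails of the \<open>D\<close>-edges that \<open>D'\<close> reverses form a set without a source: reversing an edge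
  \<open>(u, v)\<close> raises the indegree of its tail \<open>u\<close>, which must be compensated by an edge into \<open>u\<close>
  that is reversed as well, and the tail of that edge again belongs to the set.\<close>

lemma orientation_eq_if_indegree_eq:
  assumes G: "multigraph V E" and ac: "acyclic_orientation E D" and o': "orientation E D'"
    and eq: "\<And>v. v \<in> V \<Longrightarrow> indegree V D v = indegree V D' v"
  shows "D = D'"
proof (rule ccontr)
  assume "D \<noteq> D'"
  have fin: "finite V" using G by (simp add: multigraph_def)
  have o: "orientation E D" using ac by (simp add: acyclic_orientation_def)
  have rev: "count D (v, u) < count D' (v, u)" if "count D' (u, v) < count D (u, v)" for u v
    using that orientation_count[OF o, of u v] orientation_count[OF o', of u v] by linarith
  have rev': "count D' (v, u) < count D (v, u)" if "count D (u, v) < count D' (u, v)" for u v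
    using that orientation_count[OF o, of u v] orientation_count[OF o', of u v] by linarith
  define A where "A = {u. \<exists>v. count D' (u, v) < count D (u, v)}"
  have inV: "u \<in> V \<and> v \<in> V" if "count D' (u, v) < count D (u, v)" for u v
  proof -
    have "(u, v) \<in># D" using that by (simp flip: count_greater_zero_iff)
    then show ?thesis using multigraph_edge_in_vertices[OF G orientation_edge[OF o]] by blast
  qed
  have "A \<subseteq> V" using inV by (auto simp: A_def)
  then have "finite A" using fin finite_subset by blast
  have "A \<noteq> {}"
  proof -
    obtain u v where "count D (u, v) \<noteq> count D' (u, v)"
      using \<open>D \<noteq> D'\<close> by (metis multiset_eqI surj_pair)
    then have "count D' (u, v) < count D (u, v) \<or> count D' (v, u) < count D (v, u)"
      using rev' by (metis nat_neq_iff)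
    then show ?thesis by (auto simp: A_def)
  qed
  have "\<exists>w\<in>A. (w, u) \<in># D" if u: "u \<in> A" for u
  proof -
    obtain v where v: "count D' (u, v) < count D (u, v)" using u by (auto simp: A_def)
    have "\<exists>w\<in>V. count D' (w, u) < count D (w, u)"
    proof (rule ccontr)
      assume "\<not> ?thesis"
      then have "\<forall>w\<in>V. count D (w, u) \<le> count D' (w, u)" by (simp add: not_less)
      moreover have "\<exists>w\<in>V. count D (w, u) < count D' (w, u)" using rev[OF v] inV[OF v] by blast
      ultimately have "indegree V D u < indegree V D' u"
        unfolding indegree_def by (intro sum_strict_mono_ex1[OF fin])
      with eq[of u] inV[OF v] show False by simp
    qed
    then obtain w where w: "count D' (w, u) < count D (w, u)" by blast
    then have "w \<in> A" "(w, u) \<in># D" by (auto simp: A_def simp flip: count_greater_zero_iff)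
    then show ?thesis by blast
  qed
  with acyclic_orientation_source_in_subset[OF ac \<open>finite A\<close> \<open>A \<noteq> {}\<close>] show False by blast
qed

section \<open>The configuration of an orientation\<close>

definition indegree_config :: "'a set \<Rightarrow> 'a \<Rightarrow> ('a \<times> 'a) multiset \<Rightarrow> 'a \<Rightarrow> nat" where
  "indegree_config V q D = (\<lambda>v\<in>V - {q}. indegree V D v - 1)"

lemma superstable_indegree_config:
  assumes G: "multigraph V E" and "q \<in> V"
    and ac: "acyclic_orientation E D" and us: "unique_source V D q"
  shows "superstable V E q (indegree_config V q D)"
  unfolding superstable_def
proof (intro conjI allI impI)
  show "indegree_config V q D \<in> configurations V q"
    by (simp add: indegree_config_def configurations_def)
next
  fix S assume S: "S \<noteq> {} \<and> S \<subseteq> V - {q}"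
  have fin: "finite V" using G by (simp add: multigraph_def)
  have o: "orientation E D" using ac by (simp add: acyclic_orientation_def)
  have "finite S" using S fin by (meson finite_Diff finite_subset)
  then obtain v where v: "v \<in> S" "\<forall>u\<in>S. (u, v) \<notin># D"
    using acyclic_orientation_source_in_subset[OF ac, of S] S by meson
  have "indegree V D v = (\<Sum>u\<in>V - S. count D (u, v))"
    unfolding indegree_def using v(2) fin
    by (intro sum.mono_neutral_right) (auto simp: count_eq_zero_iff)
  also have "\<dots> \<le> outdeg V E S v"
    unfolding outdeg_def
  proof (rule sum_mono)
    fix u show "count D (u, v) \<le> count E {v, u}"
      using orientation_count[OF o, of v u] by linarith
  qed
  finally have "indegree V D v \<le> outdeg V E S v" .
  moreover have "0 < indegree V D v"
    using us v(1) S unique_source_iff_indegree[OF G o \<open>q \<in> V\<close>] by blast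
  ultimately show "\<exists>v\<in>S. indegree_config V q D v < outdeg V E S v"
    using v(1) S by (intro bexI[of _ v]) (auto simp: indegree_config_def)
qed

lemma indegree_config_le_iff:
  assumes G: "multigraph V E" and "q \<in> V"
    and "orientation E D" "unique_source V D q" "orientation E D'" "unique_source V D' q"
  shows "(\<forall>v\<in>V - {q}. indegree_config V q D v \<le> indegree_config V q D' v)
    \<longleftrightarrow> (\<forall>v\<in>V. indegree V D v \<le> indegree V D' v)" (is "?L \<longleftrightarrow> ?R")
proof -
  have D: "indegree V D q = 0 \<and> (\<forall>v\<in>V - {q}. 0 < indegree V D v)"
    and D': "indegree V D' q = 0 \<and> (\<forall>v\<in>V - {q}. 0 < indegree V D' v)"
    using assms unique_source_iff_indegree[OF G _ \<open>q \<in> V\<close>] by blast+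
  have "indegree V D v - 1 \<le> indegree V D' v - 1 \<longleftrightarrow> indegree V D v \<le> indegree V D' v"
    if "v \<in> V - {q}" for v
    using D D' that by (metis One_nat_def Suc_leI le_diff_iff)
  then have "?L \<longleftrightarrow> (\<forall>v\<in>V - {q}. indegree V D v \<le> indegree V D' v)"
    by (simp add: indegree_config_def)
  then show ?thesis using D \<open>q \<in> V\<close> by auto
qed

text \<open>An antichain property: since all orientations have the same number of edges, no configuration
  coming from an orientation lies strictly below another one, and acyclicity then recovers the
  orientation.\<close>

lemma acyclic_orientation_eq_if_config_le:
  assumes G: "multigraph V E" and "q \<in> V"
    and "acyclic_orientation E D" "unique_source V D q"
    and "acyclic_orientation E D'" "unique_source V D' q"
    and "\<forall>v\<in>V - {q}. indegree_config V q D v \<le> indegree_config V q D' v"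
  shows "D = D'"
proof (rule orientation_eq_if_indegree_eq[OF G assms(3)])
  have o: "orientation E D" "orientation E D'"
    using assms(3,5) by (simp_all add: acyclic_orientation_def)
  then show "orientation E D'" by blast
  have "finite V" using G by (simp add: multigraph_def)
  moreover have "\<forall>v\<in>V. indegree V D v \<le> indegree V D' v"
    using assms indegree_config_le_iff[OF G \<open>q \<in> V\<close>] o by blast
  ultimately show "indegree V D v = indegree V D' v" if "v \<in> V" for v
    using indegree_eq_if_le[OF _ o] that by blast
qed

section \<open>Dhar's burning process\<close>

text \<open>The fire starts at \<open>q\<close> and reaches a vertex once more of its edges burn than it has chips.
  While the set of unburnt vertices is nonempty, superstability applied to that set supplies the next
  vertex to burn; its rank is the number of vertices burnt before it.\<close>

lemma superstable_burning_order:
  assumes "finite V" and "q \<in> V" and ss: "superstable V E q c"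
  shows "\<exists>r :: 'a \<Rightarrow> nat. inj_on r V \<and>
           (\<forall>v\<in>V. r q \<le> r v) \<and>
           (\<forall>v\<in>V - {q}. c v < (\<Sum>u\<in>{u\<in>V. r u < r v}. count E {v, u}))"
proof -
  \<comment> \<open>The invariant holds for the set \<open>T\<close> of the first \<open>Suc k\<close> burnt vertices.\<close>
  define burnt where "burnt T r \<longleftrightarrow> inj_on r T \<and> (\<forall>v\<in>T. r q \<le> r v \<and> r v < card T) \<and>
      (\<forall>v\<in>T - {q}. c v < (\<Sum>u\<in>{u\<in>T. r u < r v}. count E {v, u}))"
    for T and r :: "'a \<Rightarrow> nat"
  have "\<exists>T r. q \<in> T \<and> T \<subseteq> V \<and> card T = Suc k \<and> burnt T r" if "Suc k \<le> card V" for k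
    using that
  proof (induction k)
    case 0
    show ?case
      using \<open>q \<in> V\<close> by (intro exI[of _ "{q}"] exI[of _ "\<lambda>_. 0"]) (auto simp: burnt_def)
  next
    case (Suc k)
    then obtain T r where T: "q \<in> T" "T \<subseteq> V" "card T = Suc k" and b: "burnt T r"
      by auto
    have finT: "finite T" using T(2) \<open>finite V\<close> finite_subset by blast
    have "T \<noteq> V" using T(3) Suc.prems by auto
    then have "V - T \<noteq> {} \<and> V - T \<subseteq> V - {q}" using T by blast
    then obtain v where v: "v \<in> V - T" "c v < outdeg V E (V - T) v"
      using ss unfolding superstable_def by meson
    have "V - (V - T) = T" using T(2) by blast
    with v(2) have cv: "c v < (\<Sum>u\<in>T. count E {v, u})" by (simp add: outdeg_def)
    define r' where "r' = r(v := card T)"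
    have r'v: "r' v = card T" by (simp add: r'_def)
    have r'T: "r' u = r u" if "u \<in> T" for u using that v(1) by (auto simp: r'_def)
    have lt: "r u < card T" if "u \<in> T" for u using b that by (auto simp: burnt_def)
    have inj: "inj_on r' (insert v T)"
    proof -
      have "inj_on r' T" using b r'T unfolding burnt_def by (metis inj_on_cong)
      moreover have "r' v \<notin> r' ` (T - {v})" using r'v r'T lt by fastforce
      ultimately show ?thesis by simp
    qed
    have "{u \<in> insert v T. r' u < r' v} = T" using r'v r'T lt by auto
    then have new: "c v < (\<Sum>u\<in>{u \<in> insert v T. r' u < r' v}. count E {v, u})"
      using cv by simp
    have old: "c w < (\<Sum>u\<in>{u \<in> insert v T. r' u < r' w}. count E {w, u})"
      if "w \<in> T - {q}" for w
    proof -
      have "{u \<in> insert v T. r' u < r' w} = {u \<in> T. r u < r w}"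
        using that r'v r'T lt[of w] by auto
      then show ?thesis using b that by (simp add: burnt_def)
    qed
    have card': "card (insert v T) = Suc (card T)" using finT v(1) by simp
    have "\<forall>w\<in>insert v T. r' q \<le> r' w \<and> r' w < card (insert v T)"
      using b T(1) r'v r'T lt card' unfolding burnt_def by (auto simp: less_SucI less_imp_le)
    then have "burnt (insert v T) r'"
      unfolding burnt_def using inj new old by blast
    with T v(1) card' show ?case
      by (intro exI[of _ "insert v T"] exI[of _ r']) auto
  qed
  moreover have "Suc (card V - 1) = card V"
    using assms(1,2) by (metis Suc_diff_1 card_gt_0_iff empty_iff)
  ultimately obtain T r where "T \<subseteq> V" "card T = card V" "burnt T r"
    by (metis order_refl)
  moreover from this have "T = V" using card_subset_eq[OF \<open>finite V\<close>] by blast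
  ultimately show ?thesis unfolding burnt_def by blast
qed

definition orient_by :: "'a set \<Rightarrow> 'a set multiset \<Rightarrow> ('a \<Rightarrow> nat) \<Rightarrow> ('a \<times> 'a) multiset" where
  "orient_by V E r =
     (\<Sum>(u, v)\<in>{(u, v)\<in>V \<times> V. r u < r v}. replicate_mset (count E {u, v}) (u, v))"

lemma count_orient_by:
  assumes "finite V"
  shows "count (orient_by V E r) (u, v) =
    (if u \<in> V \<and> v \<in> V \<and> r u < r v then count E {u, v} else 0)"
proof -
  let ?A = "{(u, v)\<in>V \<times> V. r u < r v}"
  have "finite ?A" using assms by (auto intro: finite_subset[of _ "V \<times> V"])
  have "count (orient_by V E r) (u, v) = (\<Sum>p\<in>?A. if p = (u, v) then count E {u, v} else 0)"
    unfolding orient_by_def count_sum by (intro sum.cong) (auto split: if_splits)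
  also have "\<dots> = (if (u, v) \<in> ?A then count E {u, v} else 0)"
    using \<open>finite ?A\<close> by (subst sum.delta) auto
  finally show ?thesis by simp
qed

lemma acyclic_orient_by:
  assumes G: "multigraph V E" and inj: "inj_on r V"
  shows "acyclic_orientation E (orient_by V E r)"
proof -
  let ?D = "orient_by V E r"
  have fin: "finite V" using G by (simp add: multigraph_def)
  note cnt = count_orient_by[OF fin, of E r]
  have edge: "r v < r w" if "(v, w) \<in># ?D" for v w
    using that cnt[of v w] by (metis count_eq_zero_iff)
  have "count ?D (v, w) + count ?D (w, v) = count E {v, w}" for v w
  proof (cases "{v, w} \<in># E")
    case True
    then have "v \<in> V" "w \<in> V" "v \<noteq> w" using multigraph_edge_in_vertices[OF G] by blast+
    then have "r v < r w \<or> r w < r v" using inj by (metis inj_onD nat_neq_iff)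
    then show ?thesis using cnt \<open>v \<in> V\<close> \<open>w \<in> V\<close> by (auto simp: insert_commute)
  next
    case False
    then have "count E {v, w} = 0" by (simp add: count_eq_zero_iff)
    then show ?thesis using cnt by (simp add: insert_commute)
  qed
  then have "orientation E ?D"
    unfolding orientation_def using edge by (meson less_asym)
  moreover have "distinct p" if "directed_path ?D p" for p
  proof -
    have "successively (\<lambda>v w. r v < r w) p"
      using that edge unfolding directed_path_def by (metis (no_types, lifting) successively_mono)
    then have "sorted_wrt (<) (map r p)"
      by (simp add: successively_map transp_on_less flip: successively_conv_sorted_wrt)
    then show ?thesis using strict_sorted_iff distinct_map by blast
  qed
  ultimately show ?thesis by (simp add: acyclic_orientation_def)
qed

lemma superstable_below_orientation:
  assumes G: "multigraph V E" and "q \<in> V" and ss: "superstable V E q c"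
  shows "\<exists>D. acyclic_orientation E D \<and> unique_source V D q \<and>
           (\<forall>v\<in>V - {q}. c v \<le> indegree_config V q D v)"
proof -
  have fin: "finite V" using G by (simp add: multigraph_def)
  obtain r :: "'a \<Rightarrow> nat" where inj: "inj_on r V" and rq: "\<forall>v\<in>V. r q \<le> r v"
    and burn: "\<forall>v\<in>V - {q}. c v < (\<Sum>u\<in>{u\<in>V. r u < r v}. count E {v, u})"
    using superstable_burning_order[OF fin \<open>q \<in> V\<close> ss] by blast
  let ?D = "orient_by V E r"
  have ac: "acyclic_orientation E ?D" by (rule acyclic_orient_by[OF G inj])
  then have o: "orientation E ?D" by (simp add: acyclic_orientation_def)
  have ind: "indegree V ?D v = (\<Sum>u\<in>{u\<in>V. r u < r v}. count E {v, u})" if "v \<in> V" for v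
    unfolding indegree_def using that fin
    by (simp add: count_orient_by sum.inter_filter insert_commute)
  have "{u\<in>V. r u < r q} = {}" using rq by (auto simp: not_less)
  then have "indegree V ?D q = 0" by (simp only: ind[OF \<open>q \<in> V\<close>] sum.empty)
  moreover have lt: "\<forall>v\<in>V - {q}. c v < indegree V ?D v" using burn ind by simp
  ultimately have "unique_source V ?D q"
    unfolding unique_source_iff_indegree[OF G o \<open>q \<in> V\<close>] by (metis gr0I not_less_zero)
  moreover have "\<forall>v\<in>V - {q}. c v \<le> indegree_config V q ?D v"
    unfolding indegree_config_def using lt
    by (metis Suc_leI Suc_le_mono Suc_pred' le_less_trans restrict_apply' zero_le)
  ultimately show ?thesis using ac by blast
qed

section \<open>The bijection\<close>

lemma configurations_eqI:
  assumes "c \<in> configurations V q" "c' \<in> configurations V q"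
    and "\<And>v. v \<in> V - {q} \<Longrightarrow> c v = c' v"
  shows "c = c'"
  using assms unfolding configurations_def by (rule PiE_ext)

lemma maximal_superstable_indegree_config:
  assumes G: "multigraph V E" and "q \<in> V"
    and ac: "acyclic_orientation E D" and us: "unique_source V D q"
  shows "maximal_superstable V E q (indegree_config V q D)"
  unfolding maximal_superstable_def
proof (intro conjI notI; (elim exE conjE)?)
  show ss: "superstable V E q (indegree_config V q D)"
    using assms by (rule superstable_indegree_config)
  fix c' assume c': "superstable V E q c'" "c' \<noteq> indegree_config V q D"
    and ge: "\<forall>v\<in>V - {q}. indegree_config V q D v \<le> c' v"
  obtain D' where D': "acyclic_orientation E D'" "unique_source V D' q"
    and le: "\<forall>v\<in>V - {q}. c' v \<le> indegree_config V q D' v"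
    using superstable_below_orientation[OF G \<open>q \<in> V\<close> c'(1)] by blast
  have "\<forall>v\<in>V - {q}. indegree_config V q D v \<le> indegree_config V q D' v"
    using ge le order_trans by blast
  then have "D = D'"
    by (rule acyclic_orientation_eq_if_config_le[OF G \<open>q \<in> V\<close> ac us D'])
  then have "c' = indegree_config V q D"
    using ge le c'(1) ss by (intro configurations_eqI[of _ V q])
      (auto simp: superstable_def intro: antisym)
  with c'(2) show False by blast
qed

lemma maximal_superstable_is_indegree_config:
  assumes G: "multigraph V E" and "q \<in> V" and max: "maximal_superstable V E q c"
  shows "\<exists>D. acyclic_orientation E D \<and> unique_source V D q \<and> c = indegree_config V q D"
proof -
  have "superstable V E q c" using max by (simp add: maximal_superstable_def)
  then obtain D where D: "acyclic_orientation E D" "unique_source V D q"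
    and le: "\<forall>v\<in>V - {q}. c v \<le> indegree_config V q D v"
    using superstable_below_orientation[OF G \<open>q \<in> V\<close>] by blast
  have "superstable V E q (indegree_config V q D)"
    by (rule superstable_indegree_config[OF G \<open>q \<in> V\<close> D])
  with max le have "c = indegree_config V q D" unfolding maximal_superstable_def by metis
  with D show ?thesis by blast
qed

theorem mainTheorem9:
  fixes V :: "'a set" and E :: "'a set multiset" and q :: 'a
  assumes "multigraph V E" and "connected_graph V E" and "q \<in> V"
  shows "\<exists>f. bij_betw f {c. maximal_superstable V E q c}
                        {D. acyclic_orientation E D \<and> unique_source V D q}"
proof -
  let ?C = "{c. maximal_superstable V E q c}"
  let ?O = "{D. acyclic_orientation E D \<and> unique_source V D q}"
  have "inj_on (indegree_config V q) ?O"
    by (rule inj_onI) (auto intro!: acyclic_orientation_eq_if_config_le[OF assms(1,3)])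
  moreover have "indegree_config V q ` ?O = ?C"
    using maximal_superstable_indegree_config[OF assms(1,3)]
      maximal_superstable_is_indegree_config[OF assms(1,3)] by blast
  ultimately have "bij_betw (indegree_config V q) ?O ?C" by (simp add: bij_betw_def)
  then show ?thesis using bij_betw_inv_into by blast
qed

end
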